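(* Let $S$ be an acyclic laminary set on a finite alphabet $A$ relative to an involution $\theta$. Any finite symmetric bifix code $X\subset S$ is the set of prime words in $S$ with respect to the subgroup $\langle X\rangle$ of $G_\theta$ generated by $X$. Moreover $\langle X\rangle\cap S=X^*\cap S$.
   Context: Words are over a finite alphabet $A$; $\varepsilon$ is the empty word. A set $S$ of words on $A$ is factorial if it contains $A$ and all the factors of its elements. For $w\in S$ let $L(w)=\{a\in A\mid aw\in S\}$, $R(w)=\{a\in A\mid wa\in S\}$, $B(w)=\{(a,b)\in A\times A\mid awb\in S\}$. A factorial set $S$ is biextendable if $B(w)\neq\emptyset$ for all $w\in S$. The extension graph $\mathcal{E}(w)$ is the undirected graph whose vertex set is the disjoint union of $L(w)$ and $R(w)$ and whose edges are the pairs in $B(w)$. A biextendable set $S$ is acyclic if $\mathcal{E}(w)$ is acyclic for every $w\in S$ (including $w=\varepsilon$). Let $\theta$ be an involution on $A$ (possibly with fixed points) and let $G_\theta$ be the group generated by $A$ with relations $a\theta(a)=1$, $a\in A$ (so $a^{-1}=\theta(a)$). A word is reduced if it has no factor $a\theta(a)$ with $a\in A$; every element of $G_\theta$ is represented by a unique reduced word, and reduced words are identified with elements of $G_\theta$. A laminary set on $A$ relative to $\theta$ is a biextendable set of reduced words closed under taking inverses. Symmetric means closed under taking inverses. A bifix code is a set of nonempty words in which no element is a proper prefix or a proper suffix of another. $X^*$ is the submonoid of the free monoid $A^*$ generated by $X$. For a subgroup $H$ of $G_\theta$, the set of prime words in $S$ with respect to $H$ is the set of nonempty words in $H\cap S$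 without a proper nonempty prefix in $H\cap S$. *)

theory Defs
  imports "HOL-Algebra.Generated_Groups" "HOL-Library.Sublist"
begin

section \<open>Factorial sets and extension graphs\<close>

definition factorial_set :: "'a set \<Rightarrow> 'a list set \<Rightarrow> bool" where
  "factorial_set A S \<longleftrightarrow>
     S \<subseteq> lists A \<and> (\<forall>a\<in>A. [a] \<in> S) \<and> (\<forall>w\<in>S. \<forall>u. sublist u w \<longrightarrow> u \<in> S)"

definition left_ext :: "'a set \<Rightarrow> 'a list set \<Rightarrow> 'a list \<Rightarrow> 'a set" where
  "left_ext A S w = {a \<in> A. a # w \<in> S}"

definition right_ext :: "'a set \<Rightarrow> 'a list set \<Rightarrow> 'a list \<Rightarrow> 'a set" where
  "right_ext A S w = {a \<in> A. w @ [a] \<in> S}"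

definition bi_ext :: "'a set \<Rightarrow> 'a list set \<Rightarrow> 'a list \<Rightarrow> ('a \<times> 'a) set" where
  "bi_ext A S w = {(a, b) \<in> A \<times> A. a # w @ [b] \<in> S}"

definition biextendable :: "'a set \<Rightarrow> 'a list set \<Rightarrow> bool" where
  "biextendable A S \<longleftrightarrow> factorial_set A S \<and> (\<forall>w\<in>S. bi_ext A S w \<noteq> {})"

text \<open>An undirected simple graph is a pair of a vertex set and a set of two-element edges.\<close>

type_synonym 'v ugraph = "'v set \<times> 'v set set"

definition ext_graph :: "'a set \<Rightarrow> 'a list set \<Rightarrow> 'a list \<Rightarrow> ('a + 'a) ugraph" where
  "ext_graph A S w =
     (left_ext A S w <+> right_ext A S w, {{Inl a, Inr b} | a b. (a, b) \<in> bi_ext A S w})"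

definition is_cycle :: "'v ugraph \<Rightarrow> 'v list \<Rightarrow> bool" where
  "is_cycle G c \<longleftrightarrow> length c \<ge> 3 \<and> distinct c \<and> set c \<subseteq> fst G \<and>
     (\<forall>i < length c. {c ! i, c ! (Suc i mod length c)} \<in> snd G)"

definition acyclic_graph :: "'v ugraph \<Rightarrow> bool" where
  "acyclic_graph G \<longleftrightarrow> (\<nexists>c. is_cycle G c)"

definition acyclic_set :: "'a set \<Rightarrow> 'a list set \<Rightarrow> bool" where
  "acyclic_set A S \<longleftrightarrow> biextendable A S \<and> (\<forall>w\<in>S. acyclic_graph (ext_graph A S w))"

section \<open>Groups given by generators and relations\<close>

text \<open>The letter \<open>(True, a)\<close> stands for the generator \<open>a\<close>, the letter \<open>(False, a)\<close> for its formal
  inverse. The group is the quotient of the words over these letters by the congruence generated by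
  the cancellations of inverse letters and by \<open>r = 1\<close> for the relators \<open>r\<close>.\<close>

inductive_set pres_cong ::
    "'a set \<Rightarrow> (bool \<times> 'a) list set \<Rightarrow> ((bool \<times> 'a) list \<times> (bool \<times> 'a) list) set"
  for A R where
  refl: "w \<in> lists (UNIV \<times> A) \<Longrightarrow> (w, w) \<in> pres_cong A R"
| sym: "(u, v) \<in> pres_cong A R \<Longrightarrow> (v, u) \<in> pres_cong A R"
| trans: "(u, v) \<in> pres_cong A R \<Longrightarrow> (v, w) \<in> pres_cong A R \<Longrightarrow> (u, w) \<in> pres_cong A R"
| append: "(u, u') \<in> pres_cong A R \<Longrightarrow> (v, v') \<in> pres_cong A R \<Longrightarrow> (u @ v, u' @ v') \<in> pres_cong A R"
| cancel: "a \<in> A \<Longrightarrow> ([(s, a), (\<not> s, a)], []) \<in> pres_cong A R"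
| relator: "r \<in> R \<Longrightarrow> r \<in> lists (UNIV \<times> A) \<Longrightarrow> (r, []) \<in> pres_cong A R"

definition presented_group :: "'a set \<Rightarrow> (bool \<times> 'a) list set \<Rightarrow> (bool \<times> 'a) list set monoid" where
  "presented_group A R =
     \<lparr>carrier = lists (UNIV \<times> A) // pres_cong A R,
      mult = (\<lambda>C D. \<Union>u\<in>C. \<Union>v\<in>D. pres_cong A R `` {u @ v}),
      one = pres_cong A R `` {[]}\<rparr>"

lemma pres_cong_lists:
  "(u, v) \<in> pres_cong A R \<Longrightarrow> u \<in> lists (UNIV \<times> A) \<and> v \<in> lists (UNIV \<times> A)"
  by (induction rule: pres_cong.induct) auto

lemma equiv_pres_cong: "equiv (lists (UNIV \<times> A)) (pres_cong A R)"
proof (rule equivI)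
  show "pres_cong A R \<subseteq> lists (UNIV \<times> A) \<times> lists (UNIV \<times> A)"
    by (auto dest: pres_cong_lists)
  show "refl_on (lists (UNIV \<times> A)) (pres_cong A R)"
    by (auto simp: refl_on_def intro: pres_cong.refl)
  show "Relation.sym (pres_cong A R)"
    by (auto intro: symI pres_cong.sym)
  show "Relation.trans (pres_cong A R)"
    by (auto intro: transI pres_cong.trans)
qed

lemma pres_cong_class_eq_iff:
  assumes "u \<in> lists (UNIV \<times> A)" "v \<in> lists (UNIV \<times> A)"
  shows "pres_cong A R `` {u} = pres_cong A R `` {v} \<longleftrightarrow> (u, v) \<in> pres_cong A R"
  using assms eq_equiv_class_iff[OF equiv_pres_cong] by metis

lemma presented_group_mult_class:
  assumes "u \<in> lists (UNIV \<times> A)" "v \<in> lists (UNIV \<times> A)"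
  shows "pres_cong A R `` {u} \<otimes>\<^bsub>presented_group A R\<^esub> pres_cong A R `` {v} =
    pres_cong A R `` {u @ v}"
proof -
  have eq: "pres_cong A R `` {u' @ v'} = pres_cong A R `` {u @ v}"
    if "(u, u') \<in> pres_cong A R" "(v, v') \<in> pres_cong A R" for u' v'
    using equiv_class_eq[OF equiv_pres_cong pres_cong.append[OF that]] by simp
  have "u \<in> pres_cong A R `` {u}" "v \<in> pres_cong A R `` {v}"
    using assms by (auto intro: pres_cong.refl)
  then show ?thesis
    unfolding presented_group_def monoid.simps using eq by fast
qed

lemma rev_invert_pres_cong:
  "w \<in> lists (UNIV \<times> A) \<Longrightarrow> (rev (map (apfst Not) w) @ w, []) \<in> pres_cong A R"
proof (induction w)
  case (Cons x w)
  obtain s a where x: "x = (s, a)" "a \<in> A"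
    using Cons.prems by (cases x) auto
  have w: "w \<in> lists (UNIV \<times> A)" using Cons.prems by simp
  then have w': "rev (map (apfst Not) w) \<in> lists (UNIV \<times> A)"
    by (force simp: in_lists_conv_set)
  have "([(\<not> s, a), (s, a)], []) \<in> pres_cong A R"
    using pres_cong.cancel[OF x(2), of "\<not> s"] by simp
  from pres_cong.append[OF pres_cong.append[OF pres_cong.refl[OF w'] this] pres_cong.refl[OF w]]
  have "(rev (map (apfst Not) (x # w)) @ x # w, rev (map (apfst Not) w) @ w) \<in> pres_cong A R"
    by (simp add: x)
  then show ?case using Cons.IH[OF w] pres_cong.trans by blast
qed (simp add: pres_cong.refl)

lemma group_presented_group: "group (presented_group A R)"
proof (rule groupI)
  let ?L = "lists (UNIV \<times> A)" and ?G = "presented_group A R"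
  let ?c = "\<lambda>w. pres_cong A R `` {w}"
  have carr: "\<exists>w\<in>?L. C = ?c w" if "C \<in> carrier ?G" for C
    using that by (auto simp: presented_group_def elim: quotientE)
  have cl: "?c w \<in> carrier ?G" if "w \<in> ?L" for w
    using quotientI[OF that] by (simp add: presented_group_def)
  have one: "\<one>\<^bsub>?G\<^esub> = ?c []" by (simp add: presented_group_def)
  show "\<one>\<^bsub>?G\<^esub> \<in> carrier ?G" unfolding one by (rule cl) simp
  show "x \<otimes>\<^bsub>?G\<^esub> y \<in> carrier ?G" if xy: "x \<in> carrier ?G" "y \<in> carrier ?G" for x y
  proof -
    obtain u v where "u \<in> ?L" "v \<in> ?L" "x = ?c u" "y = ?c v"
      using carr[OF xy(1)] carr[OF xy(2)] by blast
    moreover have "u @ v \<in> ?L" using calculation by simp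
    ultimately show ?thesis using cl by (simp add: presented_group_mult_class)
  qed
  show "x \<otimes>\<^bsub>?G\<^esub> y \<otimes>\<^bsub>?G\<^esub> z = x \<otimes>\<^bsub>?G\<^esub> (y \<otimes>\<^bsub>?G\<^esub> z)"
    if xyz: "x \<in> carrier ?G" "y \<in> carrier ?G" "z \<in> carrier ?G" for x y z
  proof -
    obtain u v w where "u \<in> ?L" "v \<in> ?L" "w \<in> ?L" "x = ?c u" "y = ?c v" "z = ?c w"
      using carr[OF xyz(1)] carr[OF xyz(2)] carr[OF xyz(3)] by blast
    moreover have "u @ v \<in> ?L" "v @ w \<in> ?L" using calculation by simp_all
    ultimately show ?thesis by (simp only: presented_group_mult_class append_assoc)
  qed
  show "\<one>\<^bsub>?G\<^esub> \<otimes>\<^bsub>?G\<^esub> x = x" if x: "x \<in> carrier ?G" for x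
  proof -
    obtain u where "u \<in> ?L" "x = ?c u" using carr[OF x] by blast
    then show ?thesis using presented_group_mult_class[of "[]" A u R] by (simp add: one)
  qed
  show "\<exists>y\<in>carrier ?G. y \<otimes>\<^bsub>?G\<^esub> x = \<one>\<^bsub>?G\<^esub>" if x: "x \<in> carrier ?G" for x
  proof -
    obtain u where u: "u \<in> ?L" "x = ?c u" using carr[OF x] by blast
    let ?v = "rev (map (apfst Not) u)"
    have v: "?v \<in> ?L" using u by (force simp: in_lists_conv_set)
    have "?c ?v \<otimes>\<^bsub>?G\<^esub> x = ?c (?v @ u)"
      using presented_group_mult_class[OF v u(1)] u(2) by simp
    also have "\<dots> = \<one>\<^bsub>?G\<^esub>"
      using equiv_class_eq[OF equiv_pres_cong rev_invert_pres_cong[OF u(1)]] by (simp add: one)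
    finally show ?thesis using cl[OF v] by blast
  qed
qed

section \<open>The group of an involution and laminary sets\<close>

definition involution_on :: "'a set \<Rightarrow> ('a \<Rightarrow> 'a) \<Rightarrow> bool" where
  "involution_on A \<theta> \<longleftrightarrow> (\<forall>a\<in>A. \<theta> a \<in> A \<and> \<theta> (\<theta> a) = a)"

definition G_theta :: "'a set \<Rightarrow> ('a \<Rightarrow> 'a) \<Rightarrow> (bool \<times> 'a) list set monoid" where
  "G_theta A \<theta> = presented_group A {[(True, a), (True, \<theta> a)] | a. a \<in> A}"

text \<open>The element of the group represented by a word over \<open>A\<close>. Restricted to reduced words, this is
  the map along which reduced words are identified with group elements.\<close>

definition word_elt :: "'a set \<Rightarrow> ('a \<Rightarrow> 'a) \<Rightarrow> 'a list \<Rightarrow> (bool \<times> 'a) list set" where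
  "word_elt A \<theta> w =
     pres_cong A {[(True, a), (True, \<theta> a)] | a. a \<in> A} `` {map (Pair True) w}"

definition reduced :: "'a set \<Rightarrow> ('a \<Rightarrow> 'a) \<Rightarrow> 'a list \<Rightarrow> bool" where
  "reduced A \<theta> w \<longleftrightarrow> w \<in> lists A \<and> (\<forall>a\<in>A. \<not> sublist [a, \<theta> a] w)"

definition word_inv :: "('a \<Rightarrow> 'a) \<Rightarrow> 'a list \<Rightarrow> 'a list" where
  "word_inv \<theta> w = rev (map \<theta> w)"

definition symmetric :: "('a \<Rightarrow> 'a) \<Rightarrow> 'a list set \<Rightarrow> bool" where
  "symmetric \<theta> S \<longleftrightarrow> (\<forall>w\<in>S. word_inv \<theta> w \<in> S)"

definition laminary :: "'a set \<Rightarrow> ('a \<Rightarrow> 'a) \<Rightarrow> 'a list set \<Rightarrow> bool" where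
  "laminary A \<theta> S \<longleftrightarrow>
     biextendable A S \<and> (\<forall>w\<in>S. reduced A \<theta> w) \<and> symmetric \<theta> S"

lemma group_G_theta: "group (G_theta A \<theta>)"
  unfolding G_theta_def by (rule group_presented_group)

lemma word_elt_carrier: "w \<in> lists A \<Longrightarrow> word_elt A \<theta> w \<in> carrier (G_theta A \<theta>)"
  unfolding word_elt_def G_theta_def presented_group_def
  by (auto intro!: quotientI simp: in_lists_conv_set)

lemma word_elt_Nil: "word_elt A \<theta> [] = \<one>\<^bsub>G_theta A \<theta>\<^esub>"
  by (simp add: word_elt_def G_theta_def presented_group_def)

lemma word_elt_append:
  assumes "u \<in> lists A" "v \<in> lists A"
  shows "word_elt A \<theta> (u @ v) = word_elt A \<theta> u \<otimes>\<^bsub>G_theta A \<theta>\<^esub> word_elt A \<theta> v"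
proof -
  have "map (Pair True) u \<in> lists (UNIV \<times> A)" "map (Pair True) v \<in> lists (UNIV \<times> A)"
    using assms by (auto simp: in_lists_conv_set)
  then show ?thesis
    unfolding word_elt_def G_theta_def by (simp only: presented_group_mult_class map_append)
qed

lemma word_elt_relation:
  assumes "involution_on A \<theta>" "a \<in> A"
  shows "word_elt A \<theta> [a, \<theta> a] = \<one>\<^bsub>G_theta A \<theta>\<^esub>"
proof -
  let ?R = "{[(True, a), (True, \<theta> a)] | a. a \<in> A}"
  have "([(True, a), (True, \<theta> a)], []) \<in> pres_cong A ?R"
    using assms by (intro pres_cong.relator) (auto simp: involution_on_def)
  from equiv_class_eq[OF equiv_pres_cong this] show ?thesis
    by (simp add: word_elt_def G_theta_def presented_group_def)
qed

text \<open>\<open>word_inv\<close> represents the inverse in the group.\<close>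

lemma word_elt_word_inv:
  assumes \<theta>: "involution_on A \<theta>" and w: "w \<in> lists A"
  shows "word_elt A \<theta> (word_inv \<theta> w) = inv\<^bsub>G_theta A \<theta>\<^esub> (word_elt A \<theta> w)"
proof -
  let ?G = "G_theta A \<theta>" and ?e = "word_elt A \<theta>"
  interpret group ?G by (rule group_G_theta)
  have inv_lists: "word_inv \<theta> u \<in> lists A" if "u \<in> lists A" for u
    using that \<theta> by (auto simp: word_inv_def involution_on_def in_lists_conv_set)
  have "?e w \<otimes>\<^bsub>?G\<^esub> ?e (word_inv \<theta> w) = \<one>\<^bsub>?G\<^esub>"
    using w
  proof (induction w rule: lists.induct)
    case Nil
    then show ?case by (simp add: word_inv_def word_elt_Nil)
  next
    case (Cons a w)
    note a = Cons.hyps(1) and w = Cons.hyps(2)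
    have ta: "\<theta> a \<in> A" using \<theta> a by (simp add: involution_on_def)
    have c: "?e [a] \<in> carrier ?G" "?e w \<in> carrier ?G" "?e (word_inv \<theta> w) \<in> carrier ?G"
      "?e [\<theta> a] \<in> carrier ?G"
      using a w ta inv_lists[OF w] by (auto intro!: word_elt_carrier simp del: in_lists_conv_set)
    have 1: "?e (a # w) = ?e [a] \<otimes>\<^bsub>?G\<^esub> ?e w"
      using word_elt_append[of "[a]" A w \<theta>] a w by simp
    have 2: "?e (word_inv \<theta> (a # w)) = ?e (word_inv \<theta> w) \<otimes>\<^bsub>?G\<^esub> ?e [\<theta> a]"
      using word_elt_append[of "word_inv \<theta> w" A "[\<theta> a]" \<theta>] ta inv_lists[OF w]
      by (simp add: word_inv_def)
    have 3: "?e [a] \<otimes>\<^bsub>?G\<^esub> ?e [\<theta> a] = \<one>\<^bsub>?G\<^esub>"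
      using word_elt_append[of "[a]" A "[\<theta> a]" \<theta>] word_elt_relation[OF \<theta> a] a ta by simp
    have "?e (a # w) \<otimes>\<^bsub>?G\<^esub> ?e (word_inv \<theta> (a # w)) =
        ?e [a] \<otimes>\<^bsub>?G\<^esub> (?e w \<otimes>\<^bsub>?G\<^esub> ?e (word_inv \<theta> w)) \<otimes>\<^bsub>?G\<^esub> ?e [\<theta> a]"
      using c by (simp add: 1 2 m_assoc)
    also have "\<dots> = \<one>\<^bsub>?G\<^esub>" using c 3 Cons.IH by simp
    finally show ?case .
  qed
  from inv_equality[OF inv_comm[OF this]] show ?thesis
    using word_elt_carrier w inv_lists[OF w] by metis
qed

section \<open>Bifix codes and prime words\<close>

definition bifix_code :: "'a set \<Rightarrow> 'a list set \<Rightarrow> bool" where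
  "bifix_code A X \<longleftrightarrow> X \<subseteq> lists A \<and> [] \<notin> X \<and>
     (\<forall>x\<in>X. \<forall>y\<in>X. \<not> strict_prefix x y \<and> \<not> strict_suffix x y)"

definition submonoid_gen :: "'a list set \<Rightarrow> 'a list set" where
  "submonoid_gen X = concat ` lists X"

text \<open>\<open>generated_by A \<theta> X\<close> is the subgroup generated by \<open>X\<close>; \<open>words_in A \<theta> H S\<close> is \<open>H \<inter> S\<close> as a
  set of words.\<close>

definition generated_by :: "'a set \<Rightarrow> ('a \<Rightarrow> 'a) \<Rightarrow> 'a list set \<Rightarrow> (bool \<times> 'a) list set set" where
  "generated_by A \<theta> X = generate (G_theta A \<theta>) (word_elt A \<theta> ` X)"

definition words_in ::
    "'a set \<Rightarrow> ('a \<Rightarrow> 'a) \<Rightarrow> (bool \<times> 'a) list set set \<Rightarrow> 'a list set \<Rightarrow> 'a list set" where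
  "words_in A \<theta> H S = {w \<in> S. word_elt A \<theta> w \<in> H}"

definition prime_words ::
    "'a set \<Rightarrow> ('a \<Rightarrow> 'a) \<Rightarrow> (bool \<times> 'a) list set set \<Rightarrow> 'a list set \<Rightarrow> 'a list set" where
  "prime_words A \<theta> H S =
     {w \<in> words_in A \<theta> H S. w \<noteq> [] \<and>
        \<not> (\<exists>p \<in> words_in A \<theta> H S. p \<noteq> [] \<and> strict_prefix p w)}"

end

theory Submission
  imports Defs
begin

text \<open>Call a finite nonempty set of edges sparse if it has fewer edges than end points. Acyclicity of
  the graphs \<open>E(w)\<close> makes sparse every set of edges \<open>(u, v)\<close> with \<open>u v \<in> S\<close>, \<open>u\<close> in a suffix code and
  \<open>v\<close> in a prefix code. Join two prefixes \<open>p, q\<close> of \<open>X\<close> when \<open>p q\<inverse> \<in> X\<close>; a cycle of \<open>n\<close> vertices forming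
  a suffix code would give \<open>2 n\<close> edges on \<open>2 n\<close> end points. Hence components not containing the empty
  word are suffix codes, and the trie of \<open>X\<close> modulo connectedness is a deterministic inverse automaton,
  the Stallings automaton of \<open>\<langle>X\<rangle>\<close>: it reads every element of \<open>\<langle>X\<rangle>\<close> along a loop at the base point.
  The same absence of cycles shows that a path from the base point with label in \<open>S\<close> never
  leaves the trie of \<open>X\<close> except by completing an element of \<open>X\<close>, so loops are in \<open>X\<^sup>*\<close>.\<close>

subsection \<open>Sparse edge sets\<close>

text \<open>The two sides are counted separately, as in the disjoint union of an extension graph. A
  nonempty forest satisfies the bound; the empty set does not.\<close>

definition sparse :: "('a \<times> 'b) set \<Rightarrow> bool" where
  "sparse F \<longleftrightarrow> card F < card (fst ` F) + card (snd ` F)"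

definition suffix_code :: "'a list set \<Rightarrow> bool" where
  "suffix_code U \<longleftrightarrow> [] \<notin> U \<and> (\<forall>x\<in>U. \<forall>y\<in>U. suffix x y \<longrightarrow> x = y)"

lemma suffix_code_subset: "suffix_code U \<Longrightarrow> V \<subseteq> U \<Longrightarrow> suffix_code V"
  by (auto simp: suffix_code_def)

text \<open>In a longest simple path the first vertex has a neighbour other than the second. By
  maximality it lies on the path, and the segment up to it closes to a cycle.\<close>

lemma obtain_cycle:
  fixes R :: "'v \<Rightarrow> 'v \<Rightarrow> bool"
  assumes "finite V" and "x \<in> V" "y \<in> V" "R x y"
    and sym: "\<And>u v. R u v \<Longrightarrow> R v u" and irrefl: "\<And>v. \<not> R v v"
    and extend: "\<And>u v. u \<in> V \<Longrightarrow> v \<in> V \<Longrightarrow> R u v \<Longrightarrow> \<exists>w\<in>V. w \<noteq> v \<and> R u w"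
  obtains c where "length c \<ge> 3" "distinct c" "set c \<subseteq> V"
    "\<And>i. i < length c \<Longrightarrow> R (c ! i) (c ! (Suc i mod length c))"
proof -
  let ?path = "\<lambda>xs. length xs \<ge> 2 \<and> distinct xs \<and> set xs \<subseteq> V \<and> successively R xs"
  have "?path [x, y]"
    using assms(2-4) irrefl by auto
  moreover have "\<forall>xs. ?path xs \<longrightarrow> length xs < Suc (card V)"
    using \<open>finite V\<close> by (metis card_mono distinct_card less_Suc_eq_le)
  ultimately obtain xs where xs: "?path xs" and max: "\<And>ys. ?path ys \<Longrightarrow> length ys \<le> length xs"
    using ex_has_greatest_nat[of ?path "[x, y]" length "Suc (card V)"] by auto
  obtain u v zs where uv: "xs = u # v # zs"
    using xs by (metis One_nat_def Suc_1 Suc_le_length_iff)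
  obtain w where w: "w \<in> V" "w \<noteq> v" "R u w"
    using extend[of u v] xs uv by auto
  have "w \<in> set xs"
  proof (rule ccontr)
    assume "w \<notin> set xs"
    then have "?path (w # xs)"
      using xs w uv sym by auto
    from max[OF this] show False by simp
  qed
  then obtain j where j: "j < length xs" "xs ! j = w"
    by (auto simp: in_set_conv_nth)
  have "j \<noteq> 0" using j w uv irrefl by (metis nth_Cons_0)
  moreover have "j \<noteq> 1" using j w uv by (metis One_nat_def nth_Cons_0 nth_Cons_Suc)
  ultimately have j2: "2 \<le> j" by simp
  let ?c = "take (Suc j) xs"
  have len: "length ?c = Suc j" using j by simp
  show thesis
  proof (rule that[of ?c])
    show "length ?c \<ge> 3" "distinct ?c" "set ?c \<subseteq> V"
      using len j2 xs by (auto dest: in_set_takeD)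
    fix i assume "i < length ?c"
    then consider "i < j" | "i = j" using len by linarith
    then show "R (?c ! i) (?c ! (Suc i mod length ?c))"
    proof cases
      case 1
      then show ?thesis
        using xs j len by (simp add: successively_conv_nth)
    next
      case 2
      then have "?c ! i = w" "Suc i mod length ?c = 0" "?c ! 0 = u"
        using j len uv by (simp_all del: take_Suc_Cons)
      then show ?thesis using sym[OF w(3)] by simp
    qed
  qed
qed

text \<open>Leaf removal, as in the edge count of a forest: without an end of degree one,
  \<open>obtain_cycle\<close> yields a cycle, and deleting the edge at such an end loses an end
  point.\<close>

lemma sparse_of_acyclic_graph:
  assumes acyclic: "acyclic_graph (ext_graph A S w)" and S: "factorial_set A S"
    and "finite F" "F \<noteq> {}" "F \<subseteq> bi_ext A S w"
  shows "sparse F"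
  using assms(3-5)
proof (induction "card F" arbitrary: F rule: less_induct)
  case less
  note fin = less.prems(1)
  have "\<exists>(a, b)\<in>F. (\<forall>b'. (a, b') \<in> F \<longrightarrow> b' = b) \<or> (\<forall>a'. (a', b) \<in> F \<longrightarrow> a' = a)"
  proof (rule ccontr)
    assume no_leaf: "\<not> ?thesis"
    let ?R = "\<lambda>x y. case (x, y) of (Inl a, Inr b) \<Rightarrow> (a, b) \<in> F | (Inr b, Inl a) \<Rightarrow> (a, b) \<in> F | _ \<Rightarrow> False"
    obtain a b where ab: "(a, b) \<in> F" using less.prems(2) by auto
    let ?V = "Inl ` fst ` F \<union> Inr ` snd ` F"
    obtain c where c: "length c \<ge> 3" "distinct c" "set c \<subseteq> ?V"
      "\<And>i. i < length c \<Longrightarrow> ?R (c ! i) (c ! (Suc i mod length c))"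
    proof (rule obtain_cycle[of ?V "Inl a" "Inr b" ?R])
      show "finite ?V" using fin by simp
      show "Inl a \<in> ?V" "Inr b \<in> ?V" using ab by force+
      show "?R (Inl a) (Inr b)" using ab by simp
      show "?R v u" if "?R u v" for u v using that by (auto split: sum.splits)
      show "\<not> ?R v v" for v by (auto split: sum.splits)
      show "\<exists>w\<in>?V. w \<noteq> v \<and> ?R u w" if uv: "u \<in> ?V" "v \<in> ?V" "?R u v" for u v
      proof (cases u)
        case (Inl a)
        then obtain b where "v = Inr b" "(a, b) \<in> F" using uv(3) Inl by (auto split: sum.splits)
        then obtain b' where "(a, b') \<in> F" "b' \<noteq> b" using no_leaf by blast
        then have "b' \<in> snd ` F" by force
        then show ?thesis using Inl \<open>v = Inr b\<close> \<open>(a, b') \<in> F\<close> \<open>b' \<noteq> b\<close>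
          by (intro bexI[of _ "Inr b'"]) auto
      next
        case (Inr b)
        then obtain a where "v = Inl a" "(a, b) \<in> F" using uv(3) Inr by (auto split: sum.splits)
        then obtain a' where "(a', b) \<in> F" "a' \<noteq> a" using no_leaf by blast
        then have "a' \<in> fst ` F" by force
        then show ?thesis using Inr \<open>v = Inl a\<close> \<open>(a', b) \<in> F\<close> \<open>a' \<noteq> a\<close>
          by (intro bexI[of _ "Inl a'"]) auto
      qed
    qed (rule that)
    have ext: "a \<in> left_ext A S w" "b \<in> right_ext A S w" if "(a, b) \<in> F" for a b
    proof -
      have "a \<in> A" "b \<in> A" "a # w @ [b] \<in> S"
        using that less.prems(3) by (auto simp: bi_ext_def)
      moreover have "sublist (a # w) (a # w @ [b])" "sublist (w @ [b]) (a # w @ [b])"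
        by (metis append_Cons sublist_append_rightI, metis append_Cons append_Nil sublist_append_leftI)
      ultimately show "a \<in> left_ext A S w" "b \<in> right_ext A S w"
        using S by (auto simp: left_ext_def right_ext_def factorial_set_def)
    qed
    have "is_cycle (ext_graph A S w) c"
      unfolding is_cycle_def
    proof (intro conjI allI impI c(1,2))
      show "set c \<subseteq> fst (ext_graph A S w)"
        using c(3) ext by (fastforce simp: ext_graph_def)
      show "{c ! i, c ! (Suc i mod length c)} \<in> snd (ext_graph A S w)" if "i < length c" for i
        using c(4)[OF that] less.prems(3)
        by (auto simp: ext_graph_def split: sum.splits)
    qed
    then show False using acyclic by (auto simp: acyclic_graph_def)
  qed
  then obtain a b where ab: "(a, b) \<in> F"
    and leaf: "(\<forall>b'. (a, b') \<in> F \<longrightarrow> b' = b) \<or> (\<forall>a'. (a', b) \<in> F \<longrightarrow> a' = a)"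
    by blast
  let ?F = "F - {(a, b)}"
  have card: "card F = Suc (card ?F)"
    using card.remove[OF fin ab] .
  show ?case
  proof (cases "?F = {}")
    case True
    then have "F = {(a, b)}" using ab by auto
    then show ?thesis by (simp add: sparse_def)
  next
    case False
    have "sparse ?F"
      by (rule less.hyps) (use False fin card less.prems in auto)
    moreover have "card (fst ` ?F) \<le> card (fst ` F)" "card (snd ` ?F) \<le> card (snd ` F)"
      using fin by (auto intro!: card_mono)
    moreover have "card (fst ` ?F) < card (fst ` F) \<or> card (snd ` ?F) < card (snd ` F)"
      using leaf
    proof
      assume "\<forall>b'. (a, b') \<in> F \<longrightarrow> b' = b"
      then have "a \<notin> fst ` ?F" by auto
      moreover have "a \<in> fst ` F" using ab by force
      ultimately have "fst ` ?F \<subset> fst ` F" by blast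
      then show ?thesis using fin by (simp add: psubset_card_mono)
    next
      assume "\<forall>a'. (a', b) \<in> F \<longrightarrow> a' = a"
      then have "b \<notin> snd ` ?F" by auto
      moreover have "b \<in> snd ` F" using ab by force
      ultimately have "snd ` ?F \<subset> snd ` F" by blast
      then show ?thesis using fin by (simp add: psubset_card_mono)
    qed
    ultimately show ?thesis using card unfolding sparse_def by linarith
  qed
qed

text \<open>Induction on the total length of the left words: a word \<open>a # u'\<close> of maximal length and its
  siblings \<open>b # u'\<close> are contracted to \<open>u'\<close>. The edges at the siblings satisfy the bound by
  \<open>letters\<close>, the contracted graph by induction, and the two estimates add up.\<close>

lemma sparse_suffix_code:
  fixes N :: "'a list \<Rightarrow> 'b set"
  assumes mono: "\<And>b u. N (b # u) \<subseteq> N u"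
    and letters: "\<And>u F. finite F \<Longrightarrow> F \<noteq> {} \<Longrightarrow> F \<subseteq> {(b, v). v \<in> N (b # u)} \<Longrightarrow> sparse F"
    and "finite F" "F \<noteq> {}" "F \<subseteq> {(u, v). v \<in> N u}" "suffix_code (fst ` F)"
  shows "sparse F"
  using assms(3-6)
proof (induction "sum length (fst ` F)" arbitrary: F rule: less_induct)
  case less
  note fin = less.prems(1)
  obtain u where u: "u \<in> fst ` F" and max: "\<And>x. x \<in> fst ` F \<Longrightarrow> length x \<le> length u"
    using finite_has_maximal[of "length ` fst ` F"] fin less.prems(2)
    by (smt (verit) finite_imageI image_iff image_is_empty linorder_not_le nle_le)
  have nonempty: "x \<noteq> []" if "x \<in> fst ` F" for x
    using less.prems(4) that by (auto simp: suffix_code_def)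
  have code: "x = y" if "x \<in> fst ` F" "y \<in> fst ` F" "suffix x y" for x y
    using less.prems(4) that by (auto simp: suffix_code_def)
  obtain a u' where au: "u = a # u'" using nonempty[OF u] by (cases u) auto
  define K where "K = {x \<in> fst ` F. tl x = u'}"
  define FK where "FK = {e \<in> F. tl (fst e) = u'}"
  define V where "V = snd ` FK"
  have K: "fst ` FK = K" "K \<subseteq> fst ` F" by (auto simp: FK_def K_def)
  have finK: "finite K" "finite FK" "finite V" using fin by (auto simp: K_def FK_def V_def)
  have uK: "u \<in> K" using u au by (auto simp: K_def)
  have hd_K: "x = hd x # u'" if "x \<in> K" for x
    using that nonempty[of x] by (cases x) (auto simp: K_def)
  have inj: "inj_on hd K"
    by (rule inj_onI) (metis hd_K)
  \<comment> \<open>Siblings are determined by their first letters, so dropping the common tail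
    keeps all counts and brings \<open>FK\<close> under \<open>letters\<close>.\<close>
  let ?h = "\<lambda>(x, v). (hd x, v)"
  have FK_V: "card FK < card K + card V"
  proof -
    have "inj_on ?h FK"
      using inj K by (auto simp: inj_on_def image_iff) (metis fst_conv)+
    then have "card (?h ` FK) = card FK" by (rule card_image)
    moreover have "fst ` ?h ` FK = hd ` K"
      unfolding K(1)[symmetric] by (auto simp: image_iff) force+
    then have "card (fst ` ?h ` FK) = card K" by (simp add: card_image inj)
    moreover have "snd ` ?h ` FK = V" by (force simp: V_def)
    moreover have "sparse (?h ` FK)"
    proof (rule letters[of _ u'])
      show "?h ` FK \<noteq> {}" using uK K by auto
      show "?h ` FK \<subseteq> {(b, v). v \<in> N (b # u')}"
      proof clarsimp
        fix x v assume xv: "(x, v) \<in> FK"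
        then have "x \<in> K" using K(1) by (metis fst_conv imageI)
        then show "v \<in> N (hd x # u')"
          using hd_K[of x, symmetric] xv less.prems(3) by (auto simp: FK_def)
      qed
    qed (use finK in simp)
    ultimately show ?thesis by (simp add: sparse_def)
  qed
  have card_F: "card F = card (F - FK) + card FK"
    using fin by (metis (no_types, lifting) FK_def card_Diff_subset card_mono finite_subset
        le_add_diff_inverse2 mem_Collect_eq subsetI)
  show ?case
  proof (cases "u' = []")
    case True
    then have "tl x = u'" if "x \<in> fst ` F" for x
      using max[OF that] au by (cases x) auto
    then have "FK = F" by (auto simp: FK_def)
    then show ?thesis using FK_V K by (simp add: sparse_def V_def)
  next
    case False
    define F' where "F' = (F - FK) \<union> {u'} \<times> V"
    have u'_notin: "u' \<notin> fst ` F"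
    proof
      assume "u' \<in> fst ` F"
      from code[OF this u] show False using au by (auto simp: suffix_def)
    qed
    have fst_F': "fst ` F' = insert u' (fst ` F - K)"
    proof
      show "fst ` F' \<subseteq> insert u' (fst ` F - K)"
        by (force simp: F'_def FK_def K_def)
      have "V \<noteq> {}" using uK K by (auto simp: V_def)
      then have "u' \<in> fst ` F'" by (force simp: F'_def)
      moreover have "fst ` F - K \<subseteq> fst ` F'" by (force simp: F'_def FK_def K_def)
      ultimately show "insert u' (fst ` F - K) \<subseteq> fst ` F'" by simp
    qed
    have snd_F': "snd ` F' = snd ` F"
    proof -
      have "snd ` F' = snd ` (F - FK) \<union> snd ` FK"
        by (auto simp: F'_def V_def image_Un)
      also have "\<dots> = snd ` F" by (auto simp: image_Un[symmetric] FK_def)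
      finally show ?thesis .
    qed
    have card_F': "card F' = card (F - FK) + card V"
      unfolding F'_def using fin finK u'_notin
      by (subst card_Un_disjoint) (auto simp: card_cartesian_product_singleton image_iff)
    have card_fst: "card (fst ` F') + card K = Suc (card (fst ` F))"
      unfolding fst_F' using fin finK K u'_notin
      by (simp add: card_Diff_subset card_mono)
    have "sparse F'"
    proof (rule less.hyps)
      have "sum length (fst ` F') = length u' + sum length (fst ` F - K)"
        unfolding fst_F' using u'_notin fin by simp
      also have "\<dots> < sum length K + sum length (fst ` F - K)"
        using member_le_sum[OF uK, of length] finK au by simp
      also have "\<dots> = sum length (fst ` F)"
        using sum.subset_diff[OF K(2), of length] fin by simp
      finally show "sum length (fst ` F') < sum length (fst ` F)" .
      show "finite F'" using fin finK by (simp add: F'_def)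
      show "F' \<noteq> {}" using fst_F' by auto
      show "F' \<subseteq> {(u, v). v \<in> N u}"
      proof clarify
        fix x v assume "(x, v) \<in> F'"
        then have "(x, v) \<in> F \<or> x = u' \<and> v \<in> V" by (auto simp: F'_def)
        then show "v \<in> N x"
        proof
          assume "x = u' \<and> v \<in> V"
          then obtain y where y: "(y, v) \<in> FK" "x = u'" by (auto simp: V_def)
          then have "y \<in> K" using K(1) by (metis fst_conv imageI)
          then show ?thesis
            using hd_K[of y, symmetric] y less.prems(3) mono[of "hd y" u'] by (auto simp: FK_def)
        qed (use less.prems(3) in auto)
      qed
      show "suffix_code (fst ` F')"
        unfolding suffix_code_def fst_F'
      proof (intro conjI ballI impI)
        show "[] \<notin> insert u' (fst ` F - K)" using False nonempty by blast
        have 1: "\<not> suffix x u'" if "x \<in> fst ` F" for x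
        proof
          assume s: "suffix x u'"
          then have "suffix x u" by (simp add: au suffix_ConsI)
          then have "x = u" using code that u by blast
          then show False using s suffix_length_le[OF s] au by simp
        qed
        have 2: "x \<in> K" if "x \<in> fst ` F" "suffix u' x" for x
        proof -
          obtain z where z: "x = z @ u'" using \<open>suffix u' x\<close> by (auto simp: suffix_def)
          have "length z \<le> 1" using max[OF that(1)] au z by simp
          moreover have "z \<noteq> []" using z \<open>x \<in> fst ` F\<close> u'_notin by (metis append_Nil)
          ultimately obtain b where "z = [b]" by (cases z) auto
          then show ?thesis using z that by (simp add: K_def)
        qed
        show "x = y" if "x \<in> insert u' (fst ` F - K)" "y \<in> insert u' (fst ` F - K)" "suffix x y" for x y
          using that 1 2 code by (metis DiffE insertE)
      qed
    qed
    \<comment> \<open>Contraction loses \<open>card FK - card V\<close> edges and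
      \<open>card K - 1\<close> left ends; by \<open>FK_V\<close> the former is at most the
      latter.\<close>
    then show ?thesis
      using FK_V card_F card_F' card_fst snd_F' by (simp add: sparse_def)
  qed
qed

lemma sparse_converse: "sparse (F\<inverse>) \<longleftrightarrow> sparse F"
proof -
  have "F\<inverse> = prod.swap ` F" by force
  moreover have "card (prod.swap ` F) = card F" by (rule card_image) simp
  ultimately show ?thesis
    by (simp add: sparse_def image_image add.commute)
qed

text \<open>Right words are stored reversed, so that a prefix code becomes a suffix code. Then
  \<open>sparse_suffix_code\<close> serves twice: from letters to words on the left and, with the
  sides swapped, on the right.\<close>

lemma sparse_extensions:
  assumes "acyclic_set A S"
    and F: "finite F" "F \<noteq> {}" "\<And>u v. (u, v) \<in> F \<Longrightarrow> u @ rev v \<in> S"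
    and codes: "suffix_code (fst ` F)" "suffix_code (snd ` F)"
  shows "sparse F"
proof -
  have fact: "factorial_set A S"
    using assms by (simp add: acyclic_set_def biextendable_def)
  then have lists: "S \<subseteq> lists A" and sub: "\<And>u w. w \<in> S \<Longrightarrow> sublist u w \<Longrightarrow> u \<in> S"
    by (auto simp: factorial_set_def)
  have letters: "sparse F"
    if F: "finite F" "F \<noteq> {}" "F \<subseteq> {(a, b). a # w @ [b] \<in> S}" for F w
  proof (rule sparse_of_acyclic_graph)
    obtain a b where "(a, b) \<in> F" using F(2) by auto
    then have "a # w @ [b] \<in> S" using F(3) by auto
    moreover have "sublist w (a # w @ [b])"
      by (metis append_Cons append_Nil sublist_appendI)
    ultimately have "w \<in> S" using sub by blast
    then show "acyclic_graph (ext_graph A S w)" using assms by (simp add: acyclic_set_def)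
    show "F \<subseteq> bi_ext A S w" using that lists by (auto simp: bi_ext_def)
  qed (use that fact in auto)
  have words_letters: "sparse F"
    if "finite F" "F \<noteq> {}" "F \<subseteq> {(u, b). u @ w @ [b] \<in> S}" "suffix_code (fst ` F)" for F w
  proof (rule sparse_suffix_code[of "\<lambda>u. {b. u @ w @ [b] \<in> S}"])
    show "{b. (a # u) @ w @ [b] \<in> S} \<subseteq> {b. u @ w @ [b] \<in> S}" for a u
      using sub by (auto intro: sublist_Cons_right[THEN iffD2])
    show "sparse F"
      if "finite F" "F \<noteq> {}" "F \<subseteq> {(a, b). b \<in> {b. (a # u) @ w @ [b] \<in> S}}" for u F
      using letters[of F "u @ w"] that by simp
  qed (use that in auto)
  have "sparse (F\<inverse>)"
  proof (rule sparse_suffix_code[of "\<lambda>v. {u \<in> fst ` F. u @ rev v \<in> S}"])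
    show "{u \<in> fst ` F. u @ rev (b # v) \<in> S} \<subseteq> {u \<in> fst ` F. u @ rev v \<in> S}" for b v
    proof -
      have "u @ rev v \<in> S" if "u @ rev (b # v) \<in> S" for u
        using sub[OF that, of "u @ rev v"] by (metis append_assoc rev.simps(2) sublist_append_rightI)
      then show ?thesis by blast
    qed
    show "sparse E"
      if E: "finite E" "E \<noteq> {}" "E \<subseteq> {(b, u). u \<in> {u \<in> fst ` F. u @ rev (b # v) \<in> S}}" for E v
    proof -
      have "sparse (E\<inverse>)"
      proof (rule words_letters[of _ "rev v"])
        have "fst ` (E\<inverse>) \<subseteq> fst ` F" using E(3) by auto
        with codes(1) show "suffix_code (fst ` (E\<inverse>))" by (rule suffix_code_subset)
      qed (use E in auto)
      then show ?thesis by (simp add: sparse_converse)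
    qed
    have "fst ` (F\<inverse>) = snd ` F" by force
    then show "suffix_code (fst ` (F\<inverse>))" using codes by simp
  qed (use F in force)+
  then show ?thesis by (simp add: sparse_converse)
qed

subsection \<open>Simple paths\<close>

text \<open>Loop erasure: a revisited vertex cuts the path back to its earlier visit.\<close>

lemma rtranclp_distinct_path:
  assumes "R\<^sup>*\<^sup>* x y"
  obtains xs where "xs \<noteq> []" "hd xs = x" "last xs = y" "distinct xs" "successively R xs"
proof -
  from assms have "\<exists>xs. xs \<noteq> [] \<and> hd xs = x \<and> last xs = y \<and> distinct xs \<and> successively R xs"
  proof (induction rule: rtranclp_induct)
    case base
    show ?case by (rule exI[of _ "[x]"]) simp
  next
    case (step y z)
    then obtain xs where xs: "xs \<noteq> []" "hd xs = x" "last xs = y" "distinct xs" "successively R xs"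
      by blast
    show ?case
    proof (cases "z \<in> set xs")
      case True
      then obtain ys zs where "xs = (ys @ [z]) @ zs" by (metis append.assoc append_Cons append_Nil split_list)
      with xs show ?thesis
        by (intro exI[of _ "ys @ [z]"]) (auto simp: hd_append successively_append_iff split: if_splits)
    next
      case False
      with xs step.hyps show ?thesis
        by (intro exI[of _ "xs @ [z]"]) (auto simp: successively_append_iff)
    qed
  qed
  with that show thesis by blast
qed

subsection \<open>Normal forms in the group\<close>

text \<open>Left multiplication by a letter; on reduced words it is the action in van der Waerden's
  proof that reduced words are normal forms.\<close>

definition reduce_Cons :: "('a \<Rightarrow> 'a) \<Rightarrow> 'a \<Rightarrow> 'a list \<Rightarrow> 'a list" where
  "reduce_Cons \<theta> a w = (case w of [] \<Rightarrow> [a] | b # w' \<Rightarrow> if b = \<theta> a then w' else a # w)"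

definition free_reduce :: "('a \<Rightarrow> 'a) \<Rightarrow> 'a list \<Rightarrow> 'a list" where
  "free_reduce \<theta> w = foldr (reduce_Cons \<theta>) w []"

lemma free_reduce_simps [simp]:
  "free_reduce \<theta> [] = []"
  "free_reduce \<theta> (a # w) = reduce_Cons \<theta> a (free_reduce \<theta> w)"
  by (simp_all add: free_reduce_def)

lemma reduced_Cons:
  "reduced A \<theta> (a # w) \<longleftrightarrow> a \<in> A \<and> reduced A \<theta> w \<and> (w = [] \<or> hd w \<noteq> \<theta> a)"
  by (cases w) (auto simp: reduced_def sublist_Cons_right)

lemma reduced_reduce_Cons:
  "a \<in> A \<Longrightarrow> reduced A \<theta> w \<Longrightarrow> reduced A \<theta> (reduce_Cons \<theta> a w)"
  by (cases w) (auto simp: reduce_Cons_def reduced_Cons)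

text \<open>If \<open>a\<close> cancels the head of \<open>w\<close>, reducedness of
  \<open>w\<close> keeps the next letter from being \<open>a\<close>, so \<open>\<theta> a\<close>
  is put back without cancelling.\<close>

lemma reduce_Cons_cancel:
  assumes "involution_on A \<theta>" "a \<in> A" "reduced A \<theta> w"
  shows "reduce_Cons \<theta> (\<theta> a) (reduce_Cons \<theta> a w) = w"
proof (cases w)
  case (Cons b v)
  then show ?thesis
    using assms by (cases v) (auto simp: reduce_Cons_def reduced_Cons involution_on_def)
qed (use assms in \<open>simp add: reduce_Cons_def involution_on_def\<close>)

lemma free_reduce_reduced: "reduced A \<theta> w \<Longrightarrow> free_reduce \<theta> w = w"
proof (induction w)
  case (Cons a w)
  then show ?case by (cases w) (auto simp: reduce_Cons_def reduced_Cons)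
qed simp

text \<open>Letters act on reduced words by \<open>reduce_Cons\<close>, and the defining relations
  act trivially. Words for the same element thus act alike, in particular on the empty word.\<close>

lemma free_reduce_word_elt:
  assumes \<theta>: "involution_on A \<theta>" and "u \<in> lists A" "v \<in> lists A"
    and eq: "word_elt A \<theta> u = word_elt A \<theta> v"
  shows "free_reduce \<theta> u = free_reduce \<theta> v"
proof -
  let ?R = "{[(True, a), (True, \<theta> a)] | a. a \<in> A}"
  \<comment> \<open>The formal inverse of \<open>a\<close> acts as the letter
    \<open>\<theta> a\<close>, its inverse in the group.\<close>
  define act where "act = (\<lambda>(s, a). reduce_Cons \<theta> (if s then a else \<theta> a))"
  have \<theta>A: "\<theta> a \<in> A" "\<theta> (\<theta> a) = a" if "a \<in> A" for a
    using \<theta> that by (auto simp: involution_on_def)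
  have act_reduced: "reduced A \<theta> (foldr act w r)" if "w \<in> lists (UNIV \<times> A)" "reduced A \<theta> r" for w r
    using that by (induction w) (auto simp: act_def \<theta>A intro!: reduced_reduce_Cons)
  have cancel: "reduce_Cons \<theta> a (reduce_Cons \<theta> (\<theta> a) r) = r"
    "reduce_Cons \<theta> (\<theta> a) (reduce_Cons \<theta> a r) = r" if "a \<in> A" "reduced A \<theta> r" for a r
    using reduce_Cons_cancel[OF \<theta> that] reduce_Cons_cancel[OF \<theta> \<theta>A(1)[OF that(1)] that(2)]
      \<theta>A[OF that(1)] by simp_all
  have act_cong: "foldr act w r = foldr act w' r"
    if "(w, w') \<in> pres_cong A ?R" "reduced A \<theta> r" for w w' r
    using that
  proof (induction arbitrary: r rule: pres_cong.induct)
    case (append u u' v v')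
    then show ?case
      using act_reduced pres_cong_lists[OF append.hyps(2)] by simp
  next
    case (relator x)
    then show ?case by (auto simp: act_def cancel)
  qed (auto simp: act_def cancel)
  have act_True: "foldr act (map (Pair True) w) [] = free_reduce \<theta> w" for w
    by (induction w) (simp_all add: act_def)
  have "map (Pair True) u \<in> lists (UNIV \<times> A)" "map (Pair True) v \<in> lists (UNIV \<times> A)"
    using assms by (auto simp: in_lists_conv_set)
  then have "(map (Pair True) u, map (Pair True) v) \<in> pres_cong A ?R"
    using eq unfolding word_elt_def by (simp only: pres_cong_class_eq_iff)
  from act_cong[OF this, of "[]"] show ?thesis
    by (simp add: act_True reduced_def)
qed

subsection \<open>The incidence graph\<close>

locale laminary_code =
  fixes A :: "'a set" and \<theta> :: "'a \<Rightarrow> 'a" and S X :: "'a list set"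
  assumes involution: "involution_on A \<theta>"
    and laminary: "laminary A \<theta> S"
    and acyclic: "acyclic_set A S"
    and bifix: "bifix_code A X"
    and symmetric_X: "symmetric \<theta> X"
    and X_S: "X \<subseteq> S"
begin

abbreviation winv :: "'a list \<Rightarrow> 'a list" where
  "winv \<equiv> word_inv \<theta>"

lemma \<theta>_A [simp]: "a \<in> A \<Longrightarrow> \<theta> a \<in> A" "a \<in> A \<Longrightarrow> \<theta> (\<theta> a) = a"
  using involution by (auto simp: involution_on_def)

lemma winv_simps [simp]:
  "winv [] = []" "winv (a # w) = winv w @ [\<theta> a]" "winv (u @ v) = winv v @ winv u"
  "winv w = [] \<longleftrightarrow> w = []"
  by (simp_all add: word_inv_def)

lemma winv_lists [simp]: "w \<in> lists A \<Longrightarrow> winv w \<in> lists A"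
  by (induction w) auto

lemma winv_winv [simp]: "w \<in> lists A \<Longrightarrow> winv (winv w) = w"
  by (induction w) auto

lemma S_lists: "w \<in> S \<Longrightarrow> w \<in> lists A"
  using acyclic by (auto simp: acyclic_set_def biextendable_def factorial_set_def)

lemma S_factor: "u @ v @ w \<in> S \<Longrightarrow> v \<in> S"
  using acyclic by (auto simp: acyclic_set_def biextendable_def factorial_set_def)

lemma S_prefix: "u @ v \<in> S \<Longrightarrow> u \<in> S"
  using S_factor[of "[]" u v] by simp

lemma S_suffix: "u @ v \<in> S \<Longrightarrow> v \<in> S"
  using S_factor[of u v "[]"] by simp

lemma S_reduced: "w \<in> S \<Longrightarrow> reduced A \<theta> w"
  using laminary by (simp add: laminary_def)

lemma S_no_cancel: "u @ a # \<theta> a # v \<notin> S"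
proof
  assume "u @ a # \<theta> a # v \<in> S"
  then have "[a, \<theta> a] \<in> S" using S_factor[of u "[a, \<theta> a]" v] by simp
  from S_reduced[OF this] show False by (auto simp: reduced_Cons)
qed

lemma X_winv: "w \<in> X \<Longrightarrow> winv w \<in> X"
  using symmetric_X by (simp add: symmetric_def)

lemma X_lists: "w \<in> X \<Longrightarrow> w \<in> lists A"
  using bifix by (auto simp: bifix_code_def)

lemma Nil_notin_X: "[] \<notin> X"
  using bifix by (auto simp: bifix_code_def)

lemma X_prefix: "u \<in> X \<Longrightarrow> u @ v \<in> X \<Longrightarrow> v = []"
  using bifix unfolding bifix_code_def strict_prefix_def prefix_def
  by (metis append_self_conv)

lemma X_suffix: "u \<in> X \<Longrightarrow> v @ u \<in> X \<Longrightarrow> v = []"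
  using bifix unfolding bifix_code_def strict_suffix_def suffix_def
  by (metis append_self_conv2)

text \<open>For \<open>Y = X\<close> this is the incidence graph of \<open>X\<close> with each suffix \<open>q\<close> replaced by the prefix
  \<open>winv q\<close>; this identifies a component with its inverse.\<close>

definition adj :: "'a list set \<Rightarrow> 'a list \<Rightarrow> 'a list \<Rightarrow> bool" where
  "adj Y p q \<longleftrightarrow> p \<in> lists A \<and> q \<in> lists A \<and> p @ winv q \<in> Y"

lemma adj_sym: "symmetric \<theta> Y \<Longrightarrow> adj Y p q \<Longrightarrow> adj Y q p"
  unfolding adj_def symmetric_def by (metis winv_simps(3) winv_winv)

lemma adj_S_sym: "adj S p q \<Longrightarrow> adj S q p"
  using adj_sym laminary by (simp add: laminary_def)

lemma adj_X_sym: "adj X p q \<Longrightarrow> adj X q p"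
  using adj_sym symmetric_X by simp

lemma adj_X_S: "adj X p q \<Longrightarrow> adj S p q"
  using X_S by (auto simp: adj_def)

lemma adj_S_suffix: "adj S p (q @ r) \<Longrightarrow> adj S p r"
  using S_prefix[of "p @ winv r" "winv q"] by (auto simp: adj_def)

lemma adj_S_last: "adj S (p @ [b]) (q @ [b]) \<Longrightarrow> False"
  using S_no_cancel[of p b "winv q"] by (auto simp: adj_def)

text \<open>Reading each edge in both directions gives twice as many pairs as there are vertices,
  but each side has at most one end point per vertex; \<open>sparse_extensions\<close> forbids
  this.\<close>

lemma no_suffix_code_cycle:
  assumes c: "distinct c" "length c \<ge> 3" "suffix_code (set c)"
    and path: "successively (adj S) c" and closed: "adj S (last c) (hd c)"
  shows False
proof -
  let ?n = "length c"
  let ?s = "\<lambda>i. Suc i mod ?n"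
  have edge: "adj S (c ! i) (c ! ?s i)" if "i < ?n" for i
  proof (cases "Suc i < ?n")
    case True
    then show ?thesis using path by (simp add: successively_conv_nth)
  next
    case False
    then have "i = ?n - 1" using that by simp
    moreover have "c \<noteq> []" using c by auto
    ultimately show ?thesis using closed that by (simp add: last_conv_nth hd_conv_nth)
  qed
  have s: "?s i < ?n" for i using c by (intro mod_less_divisor) linarith
  have lists: "set c \<subseteq> lists A"
    using edge by (force simp: adj_def in_set_conv_nth)
  have inj_c: "i = j" if "c ! i = c ! j" "i < ?n" "j < ?n" for i j
    using that c by (simp add: nth_eq_iff_index_eq)
  have inj_map: "u = v" if "map \<theta> u = map \<theta> v" "u \<in> set c" "v \<in> set c" for u v
    using that lists by (metis (no_types, lifting) word_inv_def winv_winv subsetD)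
  have inj_s: "i = j" if "?s i = ?s j" "i < ?n" "j < ?n" for i j
    using that by (auto simp: mod_Suc split: if_splits)
  have s_s: "?s (?s i) \<noteq> i" if "i < ?n" for i
    using that c(2) by (auto simp: mod_Suc split: if_splits)
  \<comment> \<open>A right word \<open>winv q\<close> is stored as \<open>map \<theta> q\<close>,
    its reversal, as \<open>sparse_extensions\<close> expects.\<close>
  define F1 where "F1 = (\<lambda>i. (c ! i, map \<theta> (c ! ?s i))) ` {..<?n}"
  define F2 where "F2 = (\<lambda>i. (c ! ?s i, map \<theta> (c ! i))) ` {..<?n}"
  have "card F1 = ?n"
    unfolding F1_def by (subst card_image) (auto intro!: inj_onI intro: inj_c)
  moreover have "card F2 = ?n"
    unfolding F2_def by (subst card_image) (auto intro!: inj_onI intro: inj_s inj_c s)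
  \<comment> \<open>A common pair would force the cycle to have at most two vertices.\<close>
  moreover have "F1 \<inter> F2 = {}"
  proof -
    have False if ij: "i < ?n" "j < ?n" "c ! i = c ! ?s j" "map \<theta> (c ! ?s i) = map \<theta> (c ! j)" for i j
    proof -
      have "c ! ?s i = c ! j" using inj_map[OF ij(4)] s ij by simp
      then have "?s i = j" using inj_c s ij by blast
      moreover have "i = ?s j" using inj_c s ij by blast
      ultimately show False using s_s[OF ij(2)] by simp
    qed
    then show ?thesis by (auto simp: F1_def F2_def)
  qed
  ultimately have card: "card (F1 \<union> F2) = 2 * ?n"
    by (subst card_Un_disjoint) (auto simp: F1_def F2_def)
  have fst: "fst ` (F1 \<union> F2) \<subseteq> set c" and snd: "snd ` (F1 \<union> F2) \<subseteq> map \<theta> ` set c"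
    using s by (auto simp: F1_def F2_def)
  have "sparse (F1 \<union> F2)"
  proof (rule sparse_extensions[OF acyclic])
    show "finite (F1 \<union> F2)" by (simp add: F1_def F2_def)
    show "F1 \<union> F2 \<noteq> {}" using card c(2) by auto
    show "u @ rev v \<in> S" if "(u, v) \<in> F1 \<union> F2" for u v
      using that edge adj_S_sym[OF edge]
      by (auto simp: F1_def F2_def adj_def word_inv_def)
    show "suffix_code (fst ` (F1 \<union> F2))"
      using suffix_code_subset[OF c(3) fst] .
    have "suffix_code (map \<theta> ` set c)"
      unfolding suffix_code_def
    proof (intro conjI, goal_cases)
      case 1
      show ?case using c(3) by (auto simp: suffix_code_def)
    next
      case 2
      have "map \<theta> u = map \<theta> v"
        if uv: "u \<in> set c" "v \<in> set c" "suffix (map \<theta> u) (map \<theta> v)" for u v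
      proof -
      have "map \<theta> (map \<theta> w) = w" if "w \<in> set c" for w
        using that lists by (auto simp: map_idI in_lists_conv_set subset_iff)
      then have "suffix u v" using map_mono_suffix[OF uv(3), of \<theta>] uv by simp
      then show ?thesis using c(3) uv unfolding suffix_code_def by metis
      qed
      then show ?case by blast
    qed
    from suffix_code_subset[OF this snd] show "suffix_code (snd ` (F1 \<union> F2))" .
  qed
  moreover have "card (fst ` (F1 \<union> F2)) \<le> ?n"
    using card_mono[OF _ fst] card_length[of c] by (meson List.finite_set le_trans)
  moreover have "card (snd ` (F1 \<union> F2)) \<le> ?n"
    using card_mono[OF _ snd] card_image_le[of "set c" "map \<theta>"] card_length[of c]
    by (meson List.finite_set finite_imageI le_trans)
  ultimately show False using card by (simp add: sparse_def)
qed

text \<open>All prefixes of \<open>X\<close> except the empty word and the elements of \<open>X\<close>, which together form the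
  component of the base point (\<open>conn_Nil_iff\<close>), the only one that is not a suffix code.\<close>

definition inner :: "'a list set" where
  "inner = {p. p \<noteq> [] \<and> (\<exists>t. t \<noteq> [] \<and> p @ t \<in> X)}"

definition conn :: "'a list \<Rightarrow> 'a list \<Rightarrow> bool" where
  "conn = (adj X)\<^sup>*\<^sup>*"

lemma conn_refl [simp]: "conn p p"
  by (simp add: conn_def)

lemma conn_trans [trans]: "conn p q \<Longrightarrow> conn q r \<Longrightarrow> conn p r"
  unfolding conn_def by (rule rtranclp_trans)

lemma conn_adj: "adj X p q \<Longrightarrow> conn p q"
  by (simp add: conn_def)

lemma conn_sym: "conn p q \<Longrightarrow> conn q p"
  unfolding conn_def by (metis adj_X_sym sympD sympI symp_rtranclp)

text \<open>A proper prefix of an element of \<open>X\<close> is not in \<open>X\<close>, which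
  excludes an empty \<open>q\<close>; and since \<open>p\<close> is nonempty, \<open>q\<close> is a
  proper prefix of \<open>q @ winv p\<close>.\<close>

lemma adj_inner:
  assumes "adj X p q" "p \<in> inner"
  shows "q \<in> inner"
proof -
  have "q \<noteq> []" "p \<noteq> []" using assms X_prefix[of p] by (auto simp: adj_def inner_def)
  moreover have "q @ winv p \<in> X" using adj_X_sym[OF assms(1)] by (simp add: adj_def)
  ultimately show ?thesis by (auto simp: inner_def intro!: exI[of _ "winv p"])
qed

lemma conn_inner:
  assumes "conn p q" "p \<in> inner"
  shows "q \<in> inner"
  using assms unfolding conn_def by (induction rule: rtranclp_induct) (auto intro: adj_inner)

lemma path_inner: "successively (adj X) xs \<Longrightarrow> hd xs \<in> inner \<Longrightarrow> set xs \<subseteq> inner"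
proof (induction xs)
  case (Cons x xs)
  then show ?case using adj_inner by (cases xs) auto
qed simp

lemma conn_inner_path:
  assumes "conn p q" "p \<in> inner"
  obtains xs where "xs \<noteq> []" "hd xs = p" "last xs = q" "distinct xs" "successively (adj X) xs"
    "set xs \<subseteq> inner"
  using rtranclp_distinct_path[of "adj X" p q] path_inner assms unfolding conn_def by metis

text \<open>The neighbours of the empty word are the elements of \<open>X\<close>; these have no
  other neighbour because \<open>X\<close> is a prefix code.\<close>

lemma conn_Nil_iff: "conn [] p \<longleftrightarrow> p = [] \<or> p \<in> X"
proof
  show "conn [] p" if "p = [] \<or> p \<in> X"
    using that conn_sym[OF conn_adj[of p "[]"]] X_lists by (auto simp: adj_def)
  assume "conn [] p"
  then have "(adj X)\<^sup>*\<^sup>* [] p" by (simp add: conn_def)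
  then show "p = [] \<or> p \<in> X"
  proof (induction rule: rtranclp_induct)
    case (step q r)
    from step.IH show ?case
    proof
      assume "q = []"
      then have "r \<in> X" using adj_X_sym[OF step.hyps(2)] by (simp add: adj_def)
      then show ?thesis by simp
    next
      assume "q \<in> X"
      moreover have "q @ winv r \<in> X" using step.hyps(2) by (simp add: adj_def)
      ultimately have "winv r = []" by (rule X_prefix)
      then show ?thesis by simp
    qed
  qed simp
qed

text \<open>By induction both truncated paths are suffix codes, so only the two ends remain. If the
  first were a suffix of the last, the vertex before the last would be joined in
  \<open>adj S\<close> to the first, closing the rest to a forbidden cycle.\<close>

lemma path_suffix_code:
  assumes "successively (adj X) xs" "distinct xs" "set xs \<subseteq> inner"
  shows "suffix_code (set xs)"
  using assms
proof (induction "length xs" arbitrary: xs rule: less_induct)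
  case less
  have ends: False
    if xs: "successively (adj X) ys" "distinct ys" "set ys \<subseteq> inner" "length ys = length xs"
      "length ys \<ge> 2" and suffix: "suffix (hd ys) (last ys)" for ys
  proof -
    obtain zs z where ys: "ys = zs @ [z]" using xs(5) by (cases ys rule: rev_cases) auto
    then have zs: "zs \<noteq> []" using xs(5) by auto
    have hd: "hd zs \<in> inner" "hd zs \<noteq> []" using xs(3) ys hd_in_set[OF zs] by (auto simp: inner_def)
    obtain r where r: "z = r @ hd zs"
      using suffix ys zs by (auto simp: suffix_def)
    have adj: "adj X (last zs) z" using xs(1) ys zs by (simp add: successively_append_iff)
    then have adj': "adj S (last zs) (hd zs)"
      using adj_S_suffix[of "last zs" r "hd zs"] adj_X_S r by simp
    obtain v vs where v: "zs = v # vs" using zs by (cases zs) auto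
    show False
    proof (cases vs)
      case Nil
      \<comment> \<open>One vertex remains and would be joined to itself.\<close>
      obtain v' b where "v = v' @ [b]" using hd v by (cases v rule: rev_cases) auto
      then show False using adj_S_last[of v' b v'] adj' v Nil by simp
    next
      case (Cons v2 ws)
      show False
      proof (cases ws)
        case Nil
        \<comment> \<open>Both \<open>v\<close> and \<open>r @ v\<close> are neighbours of
          \<open>v2\<close>, and \<open>X\<close> is a suffix code.\<close>
        have "adj X v2 v" using adj_X_sym[of v v2] xs(1) ys v Cons by simp
        then have "adj X v v2" "adj X z v2" using adj_X_sym adj v Cons Nil by auto
        then have "r = []" using r v X_suffix[of "v @ winv v2" r] by (auto simp: adj_def)
        then show False using r v ys xs(2) by simp
      next
        case (Cons v3 ws')
        then have "length zs \<ge> 3" using v \<open>vs = v2 # ws\<close> by simp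
        moreover have "successively (adj X) zs" using xs(1) ys by (simp add: successively_append_iff)
        moreover have "suffix_code (set zs)"
          using less.hyps[of zs] xs ys calculation by simp
        moreover have "successively (adj S) zs"
          using calculation(2) by (rule successively_mono) (auto intro: adj_X_S)
        ultimately show False using no_suffix_code_cycle[of zs] adj' xs(2) ys by simp
      qed
    qed
  qed
  show ?case
  proof (cases "length xs \<ge> 2")
    case False
    then consider "xs = []" | x where "xs = [x]" by (cases xs) (auto simp: Suc_le_eq)
    then show ?thesis using less.prems(3) by cases (auto simp: suffix_code_def inner_def)
  next
    case True
    then obtain x x' zs where x: "xs = x # x' # zs"
      by (auto simp: Suc_le_length_iff numeral_2_eq_2)
    obtain ys y where "x' # zs = ys @ [y]" by (cases "x' # zs" rule: rev_cases) auto
    then have xs: "xs = x # ys @ [y]" using x by simp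
    have "successively (adj X) (x # ys)"
      using less.prems(1) xs successively_append_iff[of "adj X" "x # ys" "[y]"] by simp
    then have "suffix_code (set (x # ys))"
      using less.hyps[of "x # ys"] less.prems(2,3) xs by simp
    moreover have "successively (adj X) (ys @ [y])"
      using less.prems(1) xs by (simp add: successively_Cons)
    then have "suffix_code (set (ys @ [y]))"
      using less.hyps[of "ys @ [y]"] less.prems(2,3) xs by simp
    moreover have "\<not> suffix x y"
      using ends[of xs] less.prems True xs by auto
    moreover have "successively (adj X) (rev xs)"
      using less.prems(1) adj_X_sym unfolding successively_rev by (rule successively_mono)
    then have "\<not> suffix y x"
      using ends[of "rev xs"] less.prems True xs by auto
    moreover have "set xs = set (x # ys) \<union> set (ys @ [y])" unfolding xs by auto
    ultimately show ?thesis
      unfolding suffix_code_def by auto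
  qed
qed

text \<open>The vertex \<open>[b]\<close> closes the path to a cycle; as no vertex ends with
  \<open>b\<close>, the suffix code property survives its insertion.\<close>

lemma no_letter_cycle:
  assumes xs: "successively (adj X) xs" "distinct xs" "set xs \<subseteq> inner" "length xs \<ge> 2"
    and b: "adj S (hd xs) [b]" "adj S (last xs) [b]" "\<forall>x\<in>set xs. last x \<noteq> b"
  shows False
proof (rule no_suffix_code_cycle[of "[b] # xs"])
  have code: "suffix_code (set xs)" using path_suffix_code xs by simp
  then show "suffix_code (set ([b] # xs))"
  proof -
    have "x \<noteq> []" "last x \<noteq> b" if "x \<in> set xs" for x
      using that b(3) xs(3) by (auto simp: inner_def)
    then have "\<not> suffix [b] x" "\<not> suffix x [b]" if "x \<in> set xs" for x
      using that by (metis last_snoc suffix_def, metis last_appendR last.simps suffix_def)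
    then show ?thesis using code by (auto simp: suffix_code_def)
  qed
  show "distinct ([b] # xs)" using xs b by auto
  have "successively (adj S) xs"
    using xs(1) by (rule successively_mono) (auto intro: adj_X_S)
  then show "successively (adj S) ([b] # xs)"
    using adj_S_sym[OF b(1)] by (auto simp: successively_Cons)
  show "adj S (last ([b] # xs)) (hd ([b] # xs))" using b xs by auto
qed (use xs in auto)

text \<open>As a word of \<open>S\<close>, \<open>u @ [a]\<close> joins \<open>u\<close> to
  \<open>[\<theta> a]\<close> in \<open>adj S\<close>. Two or more vertices before the first one
  ending with \<open>\<theta> a\<close> would give a letter cycle, so \<open>u\<close> itself is
  adjacent to such a vertex, which spells the extension in \<open>X\<close>.\<close>

lemma conn_letter_extends:
  assumes u: "u \<in> inner" "u @ [a] \<in> S" and w: "conn u (y @ [\<theta> a])"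
  shows "\<exists>t. u @ a # t \<in> X"
proof -
  have a: "a \<in> A" "u \<in> lists A" using S_lists[OF u(2)] by auto
  obtain xs where xs: "xs \<noteq> []" "hd xs = u" "last xs = y @ [\<theta> a]" "distinct xs"
    "successively (adj X) xs" "set xs \<subseteq> inner"
    using conn_inner_path[OF w u(1)] by blast
  have "\<exists>x\<in>set xs. last x = \<theta> a" using xs by (metis last_in_set last_snoc)
  then obtain ys x zs where split: "xs = ys @ x # zs" "last x = \<theta> a" "\<forall>v\<in>set ys. last v \<noteq> \<theta> a"
    using split_list_first_prop[of xs "\<lambda>x. last x = \<theta> a"] by blast
  have "x \<noteq> []" using split xs(6) by (auto simp: inner_def)
  then obtain x' where x': "x = x' @ [\<theta> a]" using split(2) by (metis append_butlast_last_id)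
  \<comment> \<open>Otherwise \<open>u\<close> ends with \<open>\<theta> a\<close> and
    \<open>u @ [a]\<close> is not reduced.\<close>
  have "ys \<noteq> []"
  proof
    assume "ys = []"
    then have "u = x' @ [\<theta> a]" using xs split x' by simp
    then show False using S_no_cancel[of x' "\<theta> a" "[]"] u(2) a by simp
  qed
  then have hd_ys: "hd ys = u" using xs split by simp
  have adj: "adj X (last ys) x" using xs(5) split \<open>ys \<noteq> []\<close> by (simp add: successively_append_iff)
  show ?thesis
  proof (cases "length ys \<ge> 2")
    case True
    have "adj S (hd ys) [\<theta> a]" using hd_ys u(2) a by (simp add: adj_def)
    moreover have "adj S (last ys) [\<theta> a]" using adj_S_suffix adj_X_S[OF adj] x' by blast
    ultimately show ?thesis
      using no_letter_cycle[of ys "\<theta> a"] xs split True by (auto simp: successively_append_iff)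
  next
    case False
    then have "ys = [u]" using \<open>ys \<noteq> []\<close> hd_ys by (cases ys; cases "tl ys") auto
    then show ?thesis using adj x' a by (auto simp: adj_def)
  qed
qed

text \<open>On a simple path, stop at the first later vertex ending with \<open>b\<close>: two or more vertices
  strictly between would close up with \<open>[b]\<close> to a cycle, so there is exactly one, and its
  extension by \<open>\<theta> b\<close> is adjacent to both shortened ends.\<close>

lemma conn_butlast:
  assumes "y1 @ [b] \<in> inner" "conn (y1 @ [b]) (y2 @ [b])"
  shows "conn y1 y2"
proof -
  have "conn y1 y2"
    if "xs \<noteq> []" "hd xs = y1 @ [b]" "last xs = y2 @ [b]" "distinct xs"
    "successively (adj X) xs" "set xs \<subseteq> inner" for xs y1
    using that
  proof (induction "length xs" arbitrary: xs y1 rule: less_induct)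
    case less
    obtain rest where rest: "xs = (y1 @ [b]) # rest" using less.prems by (cases xs) auto
    show ?case
    proof (cases "rest = []")
      case True
      then show ?thesis using less.prems rest by simp
    next
      case False
      then have "\<exists>x\<in>set rest. last x = b" using less.prems(3) rest by (metis last_ConsR last_in_set last_snoc)
      then obtain ys x zs where split: "rest = ys @ x # zs" "last x = b" "\<forall>v\<in>set ys. last v \<noteq> b"
        using split_list_first_prop[of rest "\<lambda>x. last x = b"] by blast
      have "x \<noteq> []" using split rest less.prems(6) by (auto simp: inner_def)
      then obtain y3 where y3: "x = y3 @ [b]" using split(2) by (metis append_butlast_last_id)
      have "conn y3 y2"
        by (rule less.hyps[of "x # zs"])
          (use less.prems rest split y3 in \<open>auto simp: successively_Cons successively_append_iff\<close>)
      moreover have "conn y1 y3"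
      proof (cases "ys = []")
        case True
        then have "adj X (y1 @ [b]) (y3 @ [b])" using less.prems(5) rest split y3 by simp
        then show ?thesis using adj_S_last adj_X_S by blast
      next
        case False
        have e1: "adj X (y1 @ [b]) (hd ys)"
          using less.prems(5) rest split False by (auto simp: successively_Cons)
        have e2: "adj X (last ys) (y3 @ [b])"
          using less.prems(5) rest split False y3 by (auto simp: successively_Cons successively_append_iff)
        show ?thesis
        proof (cases "length ys \<ge> 2")
          case True
          have "adj S (hd ys) [b]" using adj_S_suffix[OF adj_S_sym[OF adj_X_S[OF e1]]] .
          moreover have "adj S (last ys) [b]" using adj_S_suffix[OF adj_X_S[OF e2]] .
          ultimately show ?thesis
            using no_letter_cycle[of ys b] less.prems rest split True
            by (auto simp: successively_append_iff successively_Cons)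
        next
          case False
          then obtain v where "ys = [v]" using \<open>ys \<noteq> []\<close> by (cases ys; cases "tl ys") auto
          then have "adj X y1 (v @ [\<theta> b])" "adj X y3 (v @ [\<theta> b])"
            using e1 adj_X_sym[OF e2] by (auto simp: adj_def)
          then show ?thesis using conn_adj conn_sym conn_trans by blast
        qed
      qed
      ultimately show ?thesis using conn_trans by blast
    qed
  qed
  then show ?thesis using conn_inner_path[OF assms(2,1)] by metis
qed

subsection \<open>The Stallings automaton\<close>

definition vertices :: "'a list set" where
  "vertices = {p. p = [] \<or> (\<exists>t. p @ t \<in> X)}"

lemma vertices_cases:
  assumes "p \<in> vertices"
  obtains "p = []" | "p \<in> X" | "p \<in> inner"
proof (cases "p = []")
  case False
  then obtain t where "p @ t \<in> X" using assms by (auto simp: vertices_def)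
  then show thesis using that(2,3) False by (cases "t = []") (auto simp: inner_def)
qed (rule that(1))

text \<open>The classes of \<open>conn\<close> on \<open>vertices\<close> are the states of the Stallings automaton of the
  subgroup generated by \<open>X\<close>, with the class of the empty word as base point.\<close>

definition edge :: "'a \<Rightarrow> 'a list \<Rightarrow> 'a list \<Rightarrow> bool" where
  "edge a s t \<longleftrightarrow> a \<in> A \<and> (t = s @ [a] \<and> t \<in> vertices \<or> s = t @ [\<theta> a] \<and> s \<in> vertices)"

lemma vertices_butlast: "p @ [a] \<in> vertices \<Longrightarrow> p \<in> vertices"
  by (auto simp: vertices_def)

lemma edge_vertices: "edge a s t \<Longrightarrow> s \<in> vertices"
  using vertices_butlast by (auto simp: edge_def)

lemma edge_sym: "edge a s t \<Longrightarrow> edge (\<theta> a) t s"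
  by (auto simp: edge_def)

text \<open>An edge that appends \<open>a\<close> becomes a deletion of \<open>\<theta> a\<close>
  after passing to adjacent vertices, the inverses of suffixes of an element of \<open>X\<close>.
  This is the form that \<open>conn_butlast\<close> handles.\<close>

lemma edge_inner:
  assumes "edge a s t" "s \<in> inner"
  obtains y where "conn s (y @ [\<theta> a])" "conn t y"
proof -
  have a: "a \<in> A" using assms by (simp add: edge_def)
  from assms consider "t = s @ [a]" "t \<in> vertices" | "s = t @ [\<theta> a]"
    by (auto simp: edge_def)
  then show thesis
  proof cases
    case 1
    then obtain r where r: "s @ a # r \<in> X" by (auto simp: vertices_def)
    then have "s \<in> lists A" "r \<in> lists A" using X_lists[OF r] by auto
    then have "adj X s (winv r @ [\<theta> a])" "adj X t (winv r)"
      using r a 1 by (auto simp: adj_def simp del: in_lists_conv_set)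
    then show ?thesis using that conn_adj by blast
  next
    case 2
    show ?thesis by (rule that[of t]) (simp_all add: 2)
  qed
qed

text \<open>An element of \<open>X\<close> cannot be prolonged in the trie, and an edge back from
  \<open>t @ [\<theta> a]\<close> in \<open>X\<close> is replaced by the first edge of its inverse,
  which starts with \<open>a\<close>.\<close>

lemma edge_base:
  assumes "edge a s t" "conn [] s"
  shows "conn t [a]" "[a] \<in> vertices"
proof -
  have a: "a \<in> A" using assms by (simp add: edge_def)
  have s: "s = [] \<or> s \<in> X" using assms(2) by (simp add: conn_Nil_iff)
  from assms consider "t = s @ [a]" "t \<in> vertices" | "s = t @ [\<theta> a]"
    by (auto simp: edge_def)
  then have "conn t [a] \<and> [a] \<in> vertices"
  proof cases
    case 1
    have "s \<notin> X"
      using 1 X_prefix[of s] by (auto simp: vertices_def)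
    then show ?thesis using s 1 by simp
  next
    case 2
    then have X: "t @ [\<theta> a] \<in> X" using s by auto
    then have "adj X t [a]" using X_lists[OF X] a by (auto simp: adj_def)
    moreover have "a # winv t \<in> X" using X_winv[OF X] a by simp
    ultimately show ?thesis using conn_adj by (auto simp: vertices_def)
  qed
  then show "conn t [a]" "[a] \<in> vertices" by auto
qed

text \<open>From the base class \<open>edge_base\<close> determines the target; elsewhere both edges
  are turned into deletions of the same letter, and \<open>conn_butlast\<close> applies.\<close>

lemma edge_deterministic:
  assumes "edge a s t" "edge a s' t'" "conn s s'"
  shows "conn t t'"
proof (cases "conn [] s")
  case True
  then have "conn [] s'" using assms(3) conn_trans by blast
  then show ?thesis
    using True edge_base(1) assms(1,2) conn_sym conn_trans by blast
next
  case False
  then have s: "s \<in> inner"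
    using edge_vertices[OF assms(1)] conn_Nil_iff vertices_cases by blast
  then have s': "s' \<in> inner" using conn_inner assms(3) by blast
  obtain y where y: "conn s (y @ [\<theta> a])" "conn t y" using edge_inner[OF assms(1) s] .
  obtain y' where y': "conn s' (y' @ [\<theta> a])" "conn t' y'" using edge_inner[OF assms(2) s'] .
  have "conn (y @ [\<theta> a]) (y' @ [\<theta> a])" using y(1) y'(1) assms(3) conn_sym conn_trans by blast
  then have "conn y y'" using conn_butlast conn_inner[OF y(1) s] by blast
  then show ?thesis using y(2) y'(2) conn_sym conn_trans by blast
qed

section \<open>Runs of the automaton\<close>

text \<open>A \<open>conn\<close> step before each letter and at the end makes this a run on
  classes, free of the choice of representatives.\<close>

primrec walk :: "'a list \<Rightarrow> 'a list \<Rightarrow> 'a list \<Rightarrow> bool" where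
  "walk [] s t \<longleftrightarrow> conn s t"
| "walk (a # w) s t \<longleftrightarrow> (\<exists>p q. conn s p \<and> edge a p q \<and> walk w q t)"

lemma walk_conn: "conn s p \<Longrightarrow> walk w p t \<Longrightarrow> walk w s t"
  using conn_trans[of s p] by (cases w) auto

lemma walk_append: "walk (u @ v) s t \<longleftrightarrow> (\<exists>p. walk u s p \<and> walk v p t)"
proof (induction u arbitrary: s)
  case Nil
  have "walk v s t \<longleftrightarrow> (\<exists>p. conn s p \<and> walk v p t)"
    using walk_conn[of s _ v t] conn_refl[of s] by blast
  then show ?case by simp
next
  case (Cons a u)
  then show ?case by auto
qed

lemma walk_free_reduce: "walk w s t \<Longrightarrow> walk (free_reduce \<theta> w) s t"
proof (induction w arbitrary: s)
  case (Cons a w)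
  then obtain p q where pq: "conn s p" "edge a p q" "walk (free_reduce \<theta> w) q t" by auto
  show ?case
  proof (cases "\<exists>r. free_reduce \<theta> w = \<theta> a # r")
    case True
    then obtain r where r: "free_reduce \<theta> w = \<theta> a # r" by blast
    then obtain p' q' where p': "conn q p'" "edge (\<theta> a) p' q'" "walk r q' t" using pq(3) by auto
    have "conn p q'" using edge_deterministic[OF edge_sym[OF pq(2)] p'(2,1)] .
    then have "walk r s t" using walk_conn p'(3) pq(1) conn_trans by blast
    then show ?thesis using r by (simp add: reduce_Cons_def)
  next
    case False
    then have "free_reduce \<theta> (a # w) = a # free_reduce \<theta> w"
      by (auto simp: reduce_Cons_def split: list.splits)
    then show ?thesis using pq by auto
  qed
qed simp

lemma walk_X: "p @ q \<in> X \<Longrightarrow> walk q p []"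
proof (induction q arbitrary: p)
  case Nil
  then show ?case using conn_Nil_iff conn_sym by simp
next
  case (Cons a q)
  then have "walk q (p @ [a]) []" by simp
  moreover have "edge a p (p @ [a])"
    using X_lists[OF Cons.prems] Cons.prems by (auto simp: edge_def vertices_def)
  ultimately show ?case using conn_refl[of p] unfolding walk.simps(2) by blast
qed

lemma walk_concat: "xs \<in> lists X \<Longrightarrow> walk (concat xs) [] []"
proof (induction xs)
  case (Cons x xs)
  then have "walk x [] []" "walk (concat xs) [] []" using walk_X[of "[]" x] by auto
  then show ?case by (auto simp: walk_append)
qed simp

text \<open>The word is read with a remainder \<open>u\<close> in the trie. The next letter stays in
  the trie by \<open>edge_base\<close> or, as \<open>w\<close> is in \<open>S\<close>, by
  \<open>conn_letter_extends\<close>; a completed element of \<open>X\<close> moves to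
  \<open>xs\<close>.\<close>

lemma walk_decode:
  assumes "w \<in> S" "walk w [] s"
  shows "\<exists>xs u. xs \<in> lists X \<and> w = concat xs @ u \<and> u \<in> insert [] inner \<and> conn u s"
  using assms
proof (induction w arbitrary: s rule: rev_induct)
  case Nil
  then show ?case by (auto intro: exI[of _ "[]"])
next
  case (snoc a w)
  obtain m p q where m: "walk w [] m" "conn m p" "edge a p q" "conn q s"
    using snoc.prems(2) by (auto simp: walk_append)
  obtain xs u where xs: "xs \<in> lists X" "w = concat xs @ u" "u \<in> insert [] inner" "conn u m"
    using snoc.IH[OF S_prefix[OF snoc.prems(1)] m(1)] by blast
  have up: "conn u p" using xs(4) m(2) conn_trans by blast
  have a: "a \<in> A" using m(3) by (simp add: edge_def)
  have ua: "u @ [a] \<in> vertices"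
  proof (cases "u = []")
    case True
    then show ?thesis using edge_base(2)[OF m(3)] up by simp
  next
    case False
    then have u: "u \<in> inner" using xs(3) by simp
    obtain y where "conn p (y @ [\<theta> a])" using edge_inner[OF m(3) conn_inner[OF up u]] .
    moreover have "u @ [a] \<in> S" using snoc.prems(1) xs(2) S_suffix[of "concat xs" "u @ [a]"] by simp
    ultimately have "\<exists>t. u @ a # t \<in> X" using conn_letter_extends u up conn_trans by blast
    then show ?thesis by (auto simp: vertices_def)
  qed
  then have "edge a u (u @ [a])" using a by (simp add: edge_def)
  then have conn: "conn (u @ [a]) s"
    using edge_deterministic m(3,4) up conn_trans by blast
  from ua show ?case
  proof (cases rule: vertices_cases)
    case 2
    then have "conn [] s" using conn conn_Nil_iff conn_trans by blast
    then show ?thesis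
      using xs 2 by (intro exI[of _ "xs @ [u @ [a]]"] exI[of _ "[]"]) simp
  next
    case 3
    then show ?thesis using xs conn by (intro exI[of _ xs] exI[of _ "u @ [a]"]) simp
  qed simp
qed

section \<open>The generated subgroup and its prime words\<close>

text \<open>Since \<open>X\<close> is symmetric, inverses of generators are generators, so the
  subgroup is the image of the submonoid.\<close>

lemma generated_by_iff:
  "h \<in> generated_by A \<theta> X \<longleftrightarrow> (\<exists>xs\<in>lists X. h = word_elt A \<theta> (concat xs))"
proof
  interpret group "G_theta A \<theta>" by (rule group_G_theta)
  have concat_lists: "concat xs \<in> lists A" if "xs \<in> lists X" for xs
    using that X_lists by (induction xs) auto
  show "\<exists>xs\<in>lists X. h = word_elt A \<theta> (concat xs)" if "h \<in> generated_by A \<theta> X"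
    using that unfolding generated_by_def
  proof (induction rule: generate.induct)
    case one
    then show ?case by (intro bexI[of _ "[]"]) (auto simp: word_elt_Nil)
  next
    case (incl h)
    then obtain x where "x \<in> X" "h = word_elt A \<theta> x" by auto
    then show ?case by (intro bexI[of _ "[x]"]) auto
  next
    case (inv h)
    then obtain x where "x \<in> X" "h = word_elt A \<theta> x" by auto
    then show ?case
      using word_elt_word_inv[OF involution, of x] X_winv X_lists
      by (intro bexI[of _ "[winv x]"]) auto
  next
    case (eng h1 h2)
    then obtain xs ys where "xs \<in> lists X" "ys \<in> lists X"
      "h1 = word_elt A \<theta> (concat xs)" "h2 = word_elt A \<theta> (concat ys)" by blast
    then show ?case
      using word_elt_append[OF concat_lists concat_lists, of xs ys] by (intro bexI[of _ "xs @ ys"]) auto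
  qed
  show "h \<in> generated_by A \<theta> X" if "\<exists>xs\<in>lists X. h = word_elt A \<theta> (concat xs)"
  proof -
    have "word_elt A \<theta> (concat xs) \<in> generated_by A \<theta> X" if "xs \<in> lists X" for xs
      using that
    proof (induction xs)
      case Nil
      then show ?case unfolding generated_by_def by (simp add: word_elt_Nil generate.one)
    next
      case (Cons x xs)
      then have "word_elt A \<theta> x \<in> generated_by A \<theta> X"
        by (auto simp: generated_by_def intro: generate.incl)
      then show ?case
        using Cons word_elt_append[OF X_lists concat_lists, of x xs]
        by (auto simp: generated_by_def intro: generate.eng)
    qed
    then show ?thesis using that by blast
  qed
qed

text \<open>A word of \<open>S\<close> in the subgroup is the free reduction of a product of
  elements of \<open>X\<close>. The product labels a loop at the base point, hence so does the word,
  and decoding it leaves no remainder.\<close>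

lemma words_in_generated: "words_in A \<theta> (generated_by A \<theta> X) S = submonoid_gen X \<inter> S"
proof
  show "submonoid_gen X \<inter> S \<subseteq> words_in A \<theta> (generated_by A \<theta> X) S"
    by (auto simp: words_in_def submonoid_gen_def generated_by_iff)
  show "words_in A \<theta> (generated_by A \<theta> X) S \<subseteq> submonoid_gen X \<inter> S"
  proof
    fix w assume "w \<in> words_in A \<theta> (generated_by A \<theta> X) S"
    then obtain xs where w: "w \<in> S" and xs: "xs \<in> lists X"
      and eq: "word_elt A \<theta> w = word_elt A \<theta> (concat xs)"
      by (auto simp: words_in_def generated_by_iff)
    have "concat xs \<in> lists A" using xs X_lists by (induction xs) auto
    then have "w = free_reduce \<theta> (concat xs)"
      using free_reduce_word_elt[OF involution S_lists[OF w] _ eq] free_reduce_reduced[OF S_reduced[OF w]]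
      by simp
    then have "walk w [] []" using walk_free_reduce[OF walk_concat[OF xs]] by simp
    then obtain ys u where ys: "ys \<in> lists X" "w = concat ys @ u" "u \<in> insert [] inner" "conn u []"
      using walk_decode[OF w] by blast
    have "u = [] \<or> u \<in> X" using conn_sym[OF ys(4)] conn_Nil_iff by simp
    then have "u = []" using ys(3) X_prefix[of u] by (auto simp: inner_def)
    then show "w \<in> submonoid_gen X \<inter> S" using ys w by (auto simp: submonoid_gen_def)
  qed
qed

text \<open>Nonempty products start with an element of \<open>X\<close>, so a prime word has such a
  prefix and equals it; conversely no element of a prefix code has such a proper prefix.\<close>

lemma prime_words_generated: "prime_words A \<theta> (generated_by A \<theta> X) S = X"
proof -
  let ?W = "submonoid_gen X \<inter> S"
  have X_W: "x \<in> ?W" if "x \<in> X" for x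
  proof -
    have "concat [x] \<in> concat ` lists X" using that by (intro imageI) simp
    then show ?thesis using that X_S by (auto simp: submonoid_gen_def)
  qed
  have split: "\<exists>x\<in>X. prefix x w" if w: "w \<in> submonoid_gen X" "w \<noteq> []" for w
  proof -
    obtain xs where "xs \<in> lists X" "w = concat xs" using w(1) by (auto simp: submonoid_gen_def)
    then show ?thesis using w(2) by (cases xs) (auto intro: prefixI)
  qed
  have X_no_prefix: "\<not> strict_prefix x y" if "x \<in> X" "y \<in> X" for x y
    using bifix that by (simp add: bifix_code_def)
  show ?thesis
  proof
    show "X \<subseteq> prime_words A \<theta> (generated_by A \<theta> X) S"
    proof
      fix x assume x: "x \<in> X"
      have "\<not> strict_prefix p x" if p: "p \<in> ?W" "p \<noteq> []" for p
      proof
        assume "strict_prefix p x"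
        moreover obtain y where "y \<in> X" "prefix y p" using split p by blast
        ultimately have "strict_prefix y x" by (simp add: prefix_order.le_less_trans)
        then show False using X_no_prefix x \<open>y \<in> X\<close> by blast
      qed
      then show "x \<in> prime_words A \<theta> (generated_by A \<theta> X) S"
        using x X_W Nil_notin_X by (auto simp: prime_words_def words_in_generated)
    qed
    show "prime_words A \<theta> (generated_by A \<theta> X) S \<subseteq> X"
    proof
      fix w assume "w \<in> prime_words A \<theta> (generated_by A \<theta> X) S"
      then have w: "w \<in> ?W" "w \<noteq> []" "\<And>p. p \<in> ?W \<Longrightarrow> p \<noteq> [] \<Longrightarrow> \<not> strict_prefix p w"
        by (auto simp: prime_words_def words_in_generated)
      then obtain x where "x \<in> X" "prefix x w" using split by blast
      then show "w \<in> X"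
        using w(3)[of x] X_W Nil_notin_X by (metis prefix_order.less_le)
    qed
  qed
qed

end

theorem theorem7p8:
  fixes A :: "'a set" and \<theta> :: "'a \<Rightarrow> 'a" and S X :: "'a list set"
  assumes "finite A"
    and "involution_on A \<theta>"
    and "laminary A \<theta> S"
    and "acyclic_set A S"
    and "finite X"
    and "bifix_code A X"
    and "symmetric \<theta> X"
    and "X \<subseteq> S"
  shows "X = prime_words A \<theta> (generated_by A \<theta> X) S
    \<and> words_in A \<theta> (generated_by A \<theta> X) S = submonoid_gen X \<inter> S"
proof -
  interpret laminary_code A \<theta> S X
    using assms by unfold_locales
  show ?thesis by (simp add: prime_words_generated words_in_generated)
qed

end
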